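(* The hierarchy $(\mathrm{FO}_q)_{q\in\mathbb N}$ is strict on arithmetical structures: there is a finite relational vocabulary $\tau\supseteq\{<,+,\times\}$ such that for every $q\in\mathbb N$ there is a first-order $\tau$-sentence of quantifier rank at most $q+1$ which is not equivalent, on the class of all finite $\tau$-structures with built-in addition and multiplication, to any first-order $\tau$-sentence of quantifier rank at most $q$.
   Context: For $n\in\mathbb N$ let $[n]=\{0,\dots,n-1\}$ with natural order $<^{[n]}$, $+^{[n]}=\{(a,b,c)\in[n]^3:c=a+b\}$, $\times^{[n]}=\{(a,b,c)\in[n]^3:c=ab\}$. A finite $\tau$-structure ($<$ binary, $+,\times$ ternary) has built-in addition and multiplication if its $\{<,+,\times\}$-reduct is isomorphic to $([n],<^{[n]},+^{[n]},\times^{[n]})$ with $n$ its size. $\mathrm{FO}_q$ denotes first-order sentences of quantifier rank at most $q$. *)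

theory Defs
  imports Main
begin

text \<open>
  Relation symbols: the three arithmetical symbols (order, addition, multiplication) and a supply
  of further symbols \<open>Other i k\<close> with name \<open>i\<close> and arity \<open>k\<close>. A finite relational vocabulary
  is a finite set of symbols.
\<close>

datatype rel_sym = Lt | Add | Mul | Other nat nat

fun arity :: "rel_sym \<Rightarrow> nat" where
  "arity Lt = 2"
| "arity Add = 3"
| "arity Mul = 3"
| "arity (Other i k) = k"

definition arith_vocab :: "rel_sym set" where
  "arith_vocab = {Lt, Add, Mul}"

record 'a struct =
  univ :: "'a set"
  interp :: "rel_sym \<Rightarrow> 'a list set"

text \<open>
  The interpretation of symbols outside the vocabulary is irrelevant and left unconstrained.
\<close>

definition fin_structure :: "rel_sym set \<Rightarrow> 'a struct \<Rightarrow> bool" where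
  "fin_structure \<tau> M \<longleftrightarrow>
     finite (univ M) \<and> univ M \<noteq> {} \<and>
     (\<forall>R\<in>\<tau>. \<forall>as\<in>interp M R. length as = arity R \<and> set as \<subseteq> univ M)"

text \<open>
  Isomorphism of the \<open>\<sigma>\<close>-reducts of two structures.
\<close>

definition isomorphic_on :: "rel_sym set \<Rightarrow> 'a struct \<Rightarrow> 'b struct \<Rightarrow> bool" where
  "isomorphic_on \<sigma> M N \<longleftrightarrow>
     (\<exists>f. bij_betw f (univ M) (univ N) \<and>
        (\<forall>R\<in>\<sigma>. \<forall>as. length as = arity R \<and> set as \<subseteq> univ M \<longrightarrow>
           (as \<in> interp M R \<longleftrightarrow> map f as \<in> interp N R)))"

fun arith_interp :: "nat \<Rightarrow> rel_sym \<Rightarrow> nat list set" where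
  "arith_interp n Lt = {[a, b] | a b. a < n \<and> b < n \<and> a < b}"
| "arith_interp n Add = {[a, b, c] | a b c. a < n \<and> b < n \<and> c < n \<and> c = a + b}"
| "arith_interp n Mul = {[a, b, c] | a b c. a < n \<and> b < n \<and> c < n \<and> c = a * b}"
| "arith_interp n (Other i k) = {}"

definition arith_structure :: "nat \<Rightarrow> nat struct" where
  "arith_structure n = \<lparr>univ = {..<n}, interp = arith_interp n\<rparr>"

definition built_in_arith :: "'a struct \<Rightarrow> bool" where
  "built_in_arith M \<longleftrightarrow> isomorphic_on arith_vocab M (arith_structure (card (univ M)))"

definition arith_structures :: "rel_sym set \<Rightarrow> 'a struct set" where
  "arith_structures \<tau> = {M. fin_structure \<tau> M \<and> built_in_arith M}"

datatype fm =
    Fls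
  | Eq nat nat
  | Rel rel_sym "nat list"
  | Neg fm
  | Conj fm fm
  | Disj fm fm
  | Ex nat fm
  | All nat fm

fun sat :: "'a struct \<Rightarrow> (nat \<Rightarrow> 'a) \<Rightarrow> fm \<Rightarrow> bool" where
  "sat M s Fls \<longleftrightarrow> False"
| "sat M s (Eq x y) \<longleftrightarrow> s x = s y"
| "sat M s (Rel R xs) \<longleftrightarrow> map s xs \<in> interp M R"
| "sat M s (Neg \<phi>) \<longleftrightarrow> \<not> sat M s \<phi>"
| "sat M s (Conj \<phi> \<psi>) \<longleftrightarrow> sat M s \<phi> \<and> sat M s \<psi>"
| "sat M s (Disj \<phi> \<psi>) \<longleftrightarrow> sat M s \<phi> \<or> sat M s \<psi>"
| "sat M s (Ex x \<phi>) \<longleftrightarrow> (\<exists>a\<in>univ M. sat M (s(x := a)) \<phi>)"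
| "sat M s (All x \<phi>) \<longleftrightarrow> (\<forall>a\<in>univ M. sat M (s(x := a)) \<phi>)"

fun over_vocab :: "rel_sym set \<Rightarrow> fm \<Rightarrow> bool" where
  "over_vocab \<tau> Fls \<longleftrightarrow> True"
| "over_vocab \<tau> (Eq x y) \<longleftrightarrow> True"
| "over_vocab \<tau> (Rel R xs) \<longleftrightarrow> R \<in> \<tau> \<and> length xs = arity R"
| "over_vocab \<tau> (Neg \<phi>) \<longleftrightarrow> over_vocab \<tau> \<phi>"
| "over_vocab \<tau> (Conj \<phi> \<psi>) \<longleftrightarrow> over_vocab \<tau> \<phi> \<and> over_vocab \<tau> \<psi>"
| "over_vocab \<tau> (Disj \<phi> \<psi>) \<longleftrightarrow> over_vocab \<tau> \<phi> \<and> over_vocab \<tau> \<psi>"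
| "over_vocab \<tau> (Ex x \<phi>) \<longleftrightarrow> over_vocab \<tau> \<phi>"
| "over_vocab \<tau> (All x \<phi>) \<longleftrightarrow> over_vocab \<tau> \<phi>"

fun free_vars :: "fm \<Rightarrow> nat set" where
  "free_vars Fls = {}"
| "free_vars (Eq x y) = {x, y}"
| "free_vars (Rel R xs) = set xs"
| "free_vars (Neg \<phi>) = free_vars \<phi>"
| "free_vars (Conj \<phi> \<psi>) = free_vars \<phi> \<union> free_vars \<psi>"
| "free_vars (Disj \<phi> \<psi>) = free_vars \<phi> \<union> free_vars \<psi>"
| "free_vars (Ex x \<phi>) = free_vars \<phi> - {x}"
| "free_vars (All x \<phi>) = free_vars \<phi> - {x}"

fun quant_rank :: "fm \<Rightarrow> nat" where
  "quant_rank Fls = 0"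
| "quant_rank (Eq x y) = 0"
| "quant_rank (Rel R xs) = 0"
| "quant_rank (Neg \<phi>) = quant_rank \<phi>"
| "quant_rank (Conj \<phi> \<psi>) = max (quant_rank \<phi>) (quant_rank \<psi>)"
| "quant_rank (Disj \<phi> \<psi>) = max (quant_rank \<phi>) (quant_rank \<psi>)"
| "quant_rank (Ex x \<phi>) = Suc (quant_rank \<phi>)"
| "quant_rank (All x \<phi>) = Suc (quant_rank \<phi>)"

definition FO :: "rel_sym set \<Rightarrow> nat \<Rightarrow> fm set" where
  "FO \<tau> q = {\<phi>. over_vocab \<tau> \<phi> \<and> free_vars \<phi> = {} \<and> quant_rank \<phi> \<le> q}"

definition models :: "'a struct \<Rightarrow> fm \<Rightarrow> bool" where
  "models M \<phi> \<longleftrightarrow> (\<forall>s. range s \<subseteq> univ M \<longrightarrow> sat M s \<phi>)"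

definition equivalent_on :: "'a struct set \<Rightarrow> fm \<Rightarrow> fm \<Rightarrow> bool" where
  "equivalent_on K \<phi> \<psi> \<longleftrightarrow> (\<forall>M\<in>K. models M \<phi> \<longleftrightarrow> models M \<psi>)"

end

theory Submission
  imports Defs "HOL-Library.Nat_Bijection"
begin

text \<open>
  The proof is a counting argument. The number of rank-\<open>q\<close> types of structures is at most a
  \<open>(q + 1)\<close>-fold exponential of \<open>A\<close>, where \<open>A\<close> is the number of atoms in \<open>q\<close> variables,
  a polynomial in \<open>q\<close>. On the other hand, add to arithmetic relations that describe hereditarily
  finite sets of height \<open>q + 1\<close> over \<open>2 ^ (3 * (q + 1))\<close> urelements, where the urelement reached at
  the end of a path \<open>x\<^sub>0 \<ni> \<dots> \<ni> x\<^sub>q\<close> is recognised by the three bits that each \<open>x\<^sub>i\<close> contributes.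
  Sentences of rank \<open>q + 1\<close> tell all these sets apart, and their number is a \<open>(q + 1)\<close>-fold
  exponential of \<open>8 ^ (q + 1) > A\<close>. Hence two of the structures agree on rank \<open>q\<close> and
  differ on rank \<open>q + 1\<close>.
\<close>

section \<open>Exponential towers and binary codes of finite sets\<close>

primrec tower :: "nat \<Rightarrow> nat \<Rightarrow> nat" where
  "tower a 0 = a"
| "tower a (Suc k) = 2 ^ tower a k"

text \<open>Shifting one exponential into the base brings the number of sets and the number of types
  to the same height, so that only bases remain to be compared.\<close>

lemma tower_Suc: "tower a (Suc k) = tower (2 ^ a) k"
  by (induction k) auto

lemma tower_less_mono: "a < b \<Longrightarrow> tower a k < tower b k"
  by (induction k) auto

lemma tower_mono_height: "k \<le> l \<Longrightarrow> tower a k \<le> tower a l"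
proof (induction l rule: dec_induct)
  case (step l)
  have "tower a l \<le> tower a (Suc l)" by (simp add: less_imp_le)
  then show ?case using step.IH by linarith
qed simp

lemma set_encode_less:
  assumes "A \<subseteq> {..<n}"
  shows "set_encode A < 2 ^ n"
proof -
  have "set_encode A \<le> (\<Sum>i<n. 2 ^ i)"
    unfolding set_encode_def using assms by (intro sum_mono2) auto
  also have "\<dots> < 2 ^ n"
    by (induction n) auto
  finally show ?thesis .
qed

lemma set_decode_less:
  assumes "b \<in> set_decode r" "r < 2 ^ n"
  shows "b < n"
proof (rule ccontr)
  assume "\<not> b < n"
  then have "r < 2 ^ b"
    using assms(2) by (meson leI order_less_le_trans one_le_numeral power_increasing)
  then show False using assms(1) by (simp add: set_decode_def)
qed

lemma set_decode_eqI:
  assumes "s < 2 ^ n" "t < 2 ^ n" "\<And>b. b < n \<Longrightarrow> b \<in> set_decode s \<longleftrightarrow> b \<in> set_decode t"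
  shows "s = t"
proof -
  have "set_decode s = set_decode t" using assms set_decode_less by blast
  then show ?thesis by (metis set_decode_inverse)
qed

section \<open>Counting types\<close>

definition atoms :: "rel_sym set \<Rightarrow> nat \<Rightarrow> fm set" where
  "atoms \<tau> k = {Eq x y | x y. x < k \<and> y < k} \<union>
     {Rel R xs | R xs. R \<in> \<tau> \<and> length xs = arity R \<and> set xs \<subseteq> {..<k}}"

lemma finite_atoms_and_card:
  assumes "finite \<tau>"
  shows "finite (atoms \<tau> k) \<and> card (atoms \<tau> k) \<le> k\<^sup>2 + (\<Sum>R\<in>\<tau>. k ^ arity R)"
proof -
  let ?E = "{..<k} \<times> {..<k}"
  let ?S = "SIGMA R:\<tau>. {xs. set xs \<subseteq> {..<k} \<and> length xs = arity R}"
  have eq: "atoms \<tau> k = case_prod Eq ` ?E \<union> case_prod Rel ` ?S"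
    unfolding atoms_def by auto
  have fin: "finite ?S"
    using assms by (auto simp: finite_lists_length_eq)
  have "card (atoms \<tau> k) \<le> card ?E + card ?S"
    unfolding eq by (intro order_trans[OF card_Un_le] add_mono card_image_le fin) auto
  also have "card ?S = (\<Sum>R\<in>\<tau>. k ^ arity R)"
    using assms by (simp add: card_lists_length_eq finite_lists_length_eq)
  finally show ?thesis
    using fin unfolding eq by (simp add: power2_eq_square)
qed

text \<open>
  Types are hereditarily finite sets, stored as numbers. The parameter \<open>e\<close> numbers the atoms.
\<close>

primrec rank_type :: "(fm \<Rightarrow> nat) \<Rightarrow> fm set \<Rightarrow> 'a struct \<Rightarrow> nat \<Rightarrow> 'a list \<Rightarrow> nat" where
  "rank_type e At M 0 as = set_encode (e ` {\<alpha> \<in> At. sat M ((!) as) \<alpha>})"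
| "rank_type e At M (Suc j) as = set_encode ((\<lambda>a. rank_type e At M j (as @ [a])) ` univ M)"

text \<open>A type of rank 0 is a set of at most \<open>n\<close> atom numbers, and each further
  rank passes to sets of types, which costs one exponential.\<close>

lemma rank_type_less:
  assumes "e ` At \<subseteq> {..<n}"
  shows "rank_type e At M j as < tower n (Suc j)"
proof (induction j arbitrary: as)
  case 0
  show ?case using assms by (auto intro!: set_encode_less)
next
  case (Suc j)
  have "(\<lambda>a. rank_type e At M j (as @ [a])) ` univ M \<subseteq> {..<tower n (Suc j)}"
    using Suc by blast
  from set_encode_less[OF this] show ?case by simp
qed

lemma rank_type_Suc_eqD:
  assumes "rank_type e At M (Suc j) as = rank_type e At N (Suc j) bs"
    and "finite (univ M)" "finite (univ N)" "a \<in> univ M"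
  obtains b where "b \<in> univ N" "rank_type e At M j (as @ [a]) = rank_type e At N j (bs @ [b])"
proof -
  have "(\<lambda>a. rank_type e At M j (as @ [a])) ` univ M = (\<lambda>b. rank_type e At N j (bs @ [b])) ` univ N"
    using assms by (simp add: set_encode_eq)
  then show ?thesis using assms(4) that by blast
qed

lemma sat_atom_append:
  assumes "\<alpha> \<in> atoms \<tau> (length as)"
  shows "sat M ((!) (as @ [a])) \<alpha> \<longleftrightarrow> sat M ((!) as) \<alpha>"
proof -
  have "map ((!) (as @ [a])) xs = map ((!) as) xs" if "set xs \<subseteq> {..<length as}" for xs
    using that by (auto simp: nth_append)
  then show ?thesis
    using assms by (fastforce simp: atoms_def nth_append simp del: map_eq_conv)
qed

text \<open>Atoms are recorded only once the tuple has length \<open>q\<close>. Extending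
  \<open>as\<close> by an arbitrary element, which exists as \<open>univ M\<close> is nonempty, and
  \<open>bs\<close> by a matching one does not affect atoms about the old positions.\<close>

lemma rank_type_eq_atom:
  assumes "inj_on e (atoms \<tau> q)" "finite (atoms \<tau> q)"
    and "finite (univ M)" "finite (univ N)" "univ M \<noteq> {}"
    and "rank_type e (atoms \<tau> q) M j as = rank_type e (atoms \<tau> q) N j bs"
    and "length as + j = q" "length bs = length as" "\<alpha> \<in> atoms \<tau> (length as)"
  shows "sat M ((!) as) \<alpha> \<longleftrightarrow> sat N ((!) bs) \<alpha>"
  using assms(6-)
proof (induction j arbitrary: as bs)
  case 0
  have "e ` {\<alpha> \<in> atoms \<tau> q. sat M ((!) as) \<alpha>} = e ` {\<alpha> \<in> atoms \<tau> q. sat N ((!) bs) \<alpha>}"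
    using 0(1) assms(2) by (simp add: set_encode_eq)
  then have "{\<alpha> \<in> atoms \<tau> q. sat M ((!) as) \<alpha>} = {\<alpha> \<in> atoms \<tau> q. sat N ((!) bs) \<alpha>}"
    by (subst (asm) inj_on_image_eq_iff[OF assms(1)]) auto
  then show ?case using 0 by auto
next
  case (Suc j)
  obtain a where a: "a \<in> univ M" using assms(5) by blast
  obtain b where "b \<in> univ N"
    and b: "rank_type e (atoms \<tau> q) M j (as @ [a]) = rank_type e (atoms \<tau> q) N j (bs @ [b])"
    using rank_type_Suc_eqD[OF Suc.prems(1) assms(3,4) a] .
  have "\<alpha> \<in> atoms \<tau> (length (as @ [a]))"
    using Suc.prems(4) by (force simp: atoms_def)
  then have "sat M ((!) (as @ [a])) \<alpha> \<longleftrightarrow> sat N ((!) (bs @ [b])) \<alpha>"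
    using Suc.IH[OF b] Suc.prems by simp
  then show ?case
    using sat_atom_append Suc.prems(3,4) by metis
qed

text \<open>
  The map \<open>v\<close> sends a variable to the position of its value in the tuple; this
  is what allows formulas to reuse variables.
\<close>

lemma rank_type_eq_sat:
  assumes "inj_on e (atoms \<tau> q)" "finite (atoms \<tau> q)"
    and "finite (univ M)" "finite (univ N)" "univ M \<noteq> {}"
    and "rank_type e (atoms \<tau> q) M j as = rank_type e (atoms \<tau> q) N j bs"
    and "length as + j = q" "length bs = length as"
    and "over_vocab \<tau> \<phi>" "quant_rank \<phi> \<le> j"
    and "\<forall>x\<in>free_vars \<phi>. v x < length as \<and> s x = as ! v x \<and> s' x = bs ! v x"
  shows "sat M s \<phi> \<longleftrightarrow> sat N s' \<phi>"
  using assms(6-)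
proof (induction \<phi> arbitrary: j as bs s s' v)
  case (Eq x y)
  have "Eq (v x) (v y) \<in> atoms \<tau> (length as)"
    using Eq.prems by (auto simp: atoms_def)
  from rank_type_eq_atom[OF assms(1-5) Eq.prems(1-3) this] show ?case
    using Eq.prems by simp
next
  case (Rel R xs)
  have "Rel R (map v xs) \<in> atoms \<tau> (length as)"
    using Rel.prems by (auto simp: atoms_def)
  from rank_type_eq_atom[OF assms(1-5) Rel.prems(1-3) this]
  have "map ((!) as \<circ> v) xs \<in> interp M R \<longleftrightarrow> map ((!) bs \<circ> v) xs \<in> interp N R"
    by simp
  moreover have "map ((!) as \<circ> v) xs = map s xs" "map ((!) bs \<circ> v) xs = map s' xs"
    using Rel.prems by auto
  ultimately show ?case by simp
next
  case (Neg \<phi>)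
  from Neg.IH[OF Neg.prems(1-3)] Neg.prems(4-) show ?case by simp
next
  case (Conj \<phi> \<psi>)
  have "sat M s \<phi> \<longleftrightarrow> sat N s' \<phi>"
    by (rule Conj.IH(1)[OF Conj.prems(1-3), where v = v]) (use Conj.prems(4-) in auto)
  moreover have "sat M s \<psi> \<longleftrightarrow> sat N s' \<psi>"
    by (rule Conj.IH(2)[OF Conj.prems(1-3), where v = v]) (use Conj.prems(4-) in auto)
  ultimately show ?case by simp
next
  case (Disj \<phi> \<psi>)
  have "sat M s \<phi> \<longleftrightarrow> sat N s' \<phi>"
    by (rule Disj.IH(1)[OF Disj.prems(1-3), where v = v]) (use Disj.prems(4-) in auto)
  moreover have "sat M s \<psi> \<longleftrightarrow> sat N s' \<psi>"
    by (rule Disj.IH(2)[OF Disj.prems(1-3), where v = v]) (use Disj.prems(4-) in auto)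
  ultimately show ?case by simp
next
  case (Ex x \<phi>)
  obtain i where j: "j = Suc i" using Ex.prems(5) by (cases j) auto
  have step: "sat M (s(x := a)) \<phi> \<longleftrightarrow> sat N (s'(x := b)) \<phi>"
    if "rank_type e (atoms \<tau> q) M i (as @ [a]) = rank_type e (atoms \<tau> q) N i (bs @ [b])" for a b
  \<comment> \<open>The new element sits at index \<open>length as\<close>; redirecting
    \<open>x\<close> there overrides any earlier binding of \<open>x\<close>.\<close>
  proof (rule Ex.IH[OF that, where v = "v(x := length as)"])
    show "\<forall>y\<in>free_vars \<phi>. (v(x := length as)) y < length (as @ [a]) \<and>
        (s(x := a)) y = (as @ [a]) ! (v(x := length as)) y \<and>
        (s'(x := b)) y = (bs @ [b]) ! (v(x := length as)) y"
    proof
      fix y assume "y \<in> free_vars \<phi>"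
      then have "y \<noteq> x \<Longrightarrow> v y < length as \<and> s y = as ! v y \<and> s' y = bs ! v y"
        using Ex.prems(6) by simp
      then show "(v(x := length as)) y < length (as @ [a]) \<and>
          (s(x := a)) y = (as @ [a]) ! (v(x := length as)) y \<and>
          (s'(x := b)) y = (bs @ [b]) ! (v(x := length as)) y"
        using Ex.prems(3) by (cases "y = x") (auto simp: nth_append)
    qed
  qed (use Ex.prems j in simp_all)
  \<comment> \<open>Equality of types is used in both directions, so witnesses transfer back and
    forth.\<close>
  show ?case
    using rank_type_Suc_eqD[OF Ex.prems(1)[unfolded j] assms(3,4)]
      rank_type_Suc_eqD[OF Ex.prems(1)[unfolded j, symmetric] assms(4,3)] step
    by (metis sat.simps(7))
next
  case (All x \<phi>)
  obtain i where j: "j = Suc i" using All.prems(5) by (cases j) auto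
  have step: "sat M (s(x := a)) \<phi> \<longleftrightarrow> sat N (s'(x := b)) \<phi>"
    if "rank_type e (atoms \<tau> q) M i (as @ [a]) = rank_type e (atoms \<tau> q) N i (bs @ [b])" for a b
  proof (rule All.IH[OF that, where v = "v(x := length as)"])
    show "\<forall>y\<in>free_vars \<phi>. (v(x := length as)) y < length (as @ [a]) \<and>
        (s(x := a)) y = (as @ [a]) ! (v(x := length as)) y \<and>
        (s'(x := b)) y = (bs @ [b]) ! (v(x := length as)) y"
    proof
      fix y assume "y \<in> free_vars \<phi>"
      then have "y \<noteq> x \<Longrightarrow> v y < length as \<and> s y = as ! v y \<and> s' y = bs ! v y"
        using All.prems(6) by simp
      then show "(v(x := length as)) y < length (as @ [a]) \<and>
          (s(x := a)) y = (as @ [a]) ! (v(x := length as)) y \<and>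
          (s'(x := b)) y = (bs @ [b]) ! (v(x := length as)) y"
        using All.prems(3) by (cases "y = x") (auto simp: nth_append)
    qed
  qed (use All.prems j in simp_all)
  show ?case
    using rank_type_Suc_eqD[OF All.prems(1)[unfolded j] assms(3,4)]
      rank_type_Suc_eqD[OF All.prems(1)[unfolded j, symmetric] assms(4,3)] step
    by (metis sat.simps(8))
qed simp

section \<open>Hereditarily finite sets in arithmetical structures\<close>

abbreviation "Top \<equiv> Other 0 1"
abbreviation "Child \<equiv> Other 1 2"
abbreviation "Bit j \<equiv> Other (2 + j) 2"

definition set_vocab :: "rel_sym set" where
  "set_vocab = {Lt, Add, Mul, Top, Child, Bit 0, Bit 1, Bit 2}"

text \<open>
  The element \<open>a\<close> stands for the set coded by \<open>a div (q + 1)\<close>, placed at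
  level \<open>a mod (q + 1)\<close>. Elements of level \<open>q\<close> are urelements.
\<close>

fun set_interp :: "nat \<Rightarrow> nat \<Rightarrow> nat \<Rightarrow> rel_sym \<Rightarrow> nat list set" where
  "set_interp q u n (Other i k) =
     (if i = 0 \<and> k = 1 then {[a] | a. a < n \<and> a mod Suc q = 0 \<and> a div Suc q \<in> set_decode u}
      else if i = 1 \<and> k = 2 then {[a, b] | a b. a < n \<and> b < n \<and>
        b mod Suc q = Suc (a mod Suc q) \<and> b div Suc q \<in> set_decode (a div Suc q)}
      else if k = 2 then {[a, b] | a b. a < n \<and> b < n \<and>
        3 * (a mod Suc q) + (i - 2) \<in> set_decode (b div Suc q)}
      else {})"
| "set_interp q u n R = arith_interp n R"

text \<open>\<open>level_size q 0\<close> is the number of bits of a urelement, three for each of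
  the \<open>q + 1\<close> path elements. \<open>level_size q (Suc d)\<close> counts the codes of
  sets of height \<open>d\<close>, urelements having height 0.\<close>

definition level_size :: "nat \<Rightarrow> nat \<Rightarrow> nat" where
  "level_size q d = tower (3 * Suc q) d"

text \<open>The universe has one number for each pair of a code below
  \<open>level_size q (Suc q)\<close> and a level at most \<open>q\<close>. The set \<open>u\<close>
  enters only through \<open>Top\<close>.\<close>

definition set_structure :: "nat \<Rightarrow> nat \<Rightarrow> nat struct" where
  "set_structure q u = (let n = level_size q (Suc q) * Suc q
     in \<lparr>univ = {..<n}, interp = set_interp q u n\<rparr>)"

lemma univ_set_structure: "univ (set_structure q u) = {..<level_size q (Suc q) * Suc q}"
  by (simp add: set_structure_def Let_def)

lemma finite_univ_set_structure: "finite (univ (set_structure q u))"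
  by (simp add: univ_set_structure)

lemma univ_set_structure_nonempty: "univ (set_structure q u) \<noteq> {}"
proof -
  have "level_size q (Suc q) * Suc q > 0"
    by (simp add: level_size_def)
  then show ?thesis unfolding univ_set_structure by blast
qed

lemma set_structure_arith: "set_structure q u \<in> arith_structures set_vocab"
proof -
  let ?M = "set_structure q u"
  have "fin_structure set_vocab ?M"
    using finite_univ_set_structure univ_set_structure_nonempty
    unfolding fin_structure_def by (auto simp: set_vocab_def set_structure_def Let_def)
  moreover have "built_in_arith ?M"
    unfolding built_in_arith_def isomorphic_on_def
    by (intro exI[of _ id]) (auto simp: set_structure_def Let_def arith_structure_def arith_vocab_def)
  ultimately show ?thesis
    by (simp add: arith_structures_def)
qed

section \<open>Formulas that identify the coded sets\<close>

definition Conjs :: "fm list \<Rightarrow> fm" where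
  "Conjs \<phi>s = foldr Conj \<phi>s (Neg Fls)"

lemma sat_Conjs: "sat M s (Conjs \<phi>s) \<longleftrightarrow> (\<forall>\<phi>\<in>set \<phi>s. sat M s \<phi>)"
  by (induction \<phi>s) (auto simp: Conjs_def)

lemma over_vocab_Conjs: "over_vocab \<tau> (Conjs \<phi>s) \<longleftrightarrow> (\<forall>\<phi>\<in>set \<phi>s. over_vocab \<tau> \<phi>)"
  by (induction \<phi>s) (auto simp: Conjs_def)

lemma free_vars_Conjs: "free_vars (Conjs \<phi>s) = (\<Union>\<phi>\<in>set \<phi>s. free_vars \<phi>)"
  by (induction \<phi>s) (auto simp: Conjs_def)

lemma quant_rank_Conjs_le: "quant_rank (Conjs \<phi>s) \<le> r \<longleftrightarrow> (\<forall>\<phi>\<in>set \<phi>s. quant_rank \<phi> \<le> r)"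
  by (induction \<phi>s) (auto simp: Conjs_def)

definition has_bits :: "nat \<Rightarrow> nat \<Rightarrow> (nat \<Rightarrow> fm) \<Rightarrow> fm" where
  "has_bits n t \<psi> = Conjs (map (\<lambda>b. if b \<in> set_decode t then \<psi> b else Neg (\<psi> b)) [0..<n])"

lemma sat_has_bits:
  "sat M s (has_bits n t \<psi>) \<longleftrightarrow> (\<forall>b<n. b \<in> set_decode t \<longleftrightarrow> sat M s (\<psi> b))"
proof -
  have "sat M s (has_bits n t \<psi>) \<longleftrightarrow>
      (\<forall>b<n. sat M s (if b \<in> set_decode t then \<psi> b else Neg (\<psi> b)))"
    unfolding has_bits_def sat_Conjs set_map set_upt atLeast0LessThan
    by (simp only: Ball_image_comp) (simp add: Ball_def)
  then show ?thesis by auto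
qed

lemma over_vocab_has_bits:
  "(\<And>b. b < n \<Longrightarrow> over_vocab \<tau> (\<psi> b)) \<Longrightarrow> over_vocab \<tau> (has_bits n t \<psi>)"
  unfolding has_bits_def over_vocab_Conjs set_map Ball_image_comp by simp

lemma free_vars_has_bits:
  "(\<And>b. b < n \<Longrightarrow> free_vars (\<psi> b) \<subseteq> X) \<Longrightarrow> free_vars (has_bits n t \<psi>) \<subseteq> X"
  unfolding has_bits_def free_vars_Conjs set_map image_image by (rule UN_least) simp

lemma quant_rank_has_bits:
  "(\<And>b. b < n \<Longrightarrow> quant_rank (\<psi> b) \<le> r) \<Longrightarrow> quant_rank (has_bits n t \<psi>) \<le> r"
  unfolding has_bits_def quant_rank_Conjs_le set_map Ball_image_comp by simp

text \<open>
  If the variables \<open>0, \<dots>, q - d\<close> hold elements of these levels, then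
  \<open>is_set q d t\<close> says that the last of them stands for \<open>t\<close>.
\<close>

primrec is_set :: "nat \<Rightarrow> nat \<Rightarrow> nat \<Rightarrow> fm" where
  "is_set q 0 t = has_bits (level_size q 0) t (\<lambda>b. Rel (Bit (b mod 3)) [b div 3, q])"
| "is_set q (Suc d) t = has_bits (level_size q (Suc d)) t
     (\<lambda>b. Ex (q - d) (Conj (Rel Child [q - Suc d, q - d]) (is_set q d b)))"

lemma over_vocab_is_set: "over_vocab set_vocab (is_set q d t)"
proof (induction d arbitrary: t)
  case 0
  have "Bit (b mod 3) \<in> set_vocab" for b
  proof -
    have "b mod 3 = 0 \<or> b mod 3 = 1 \<or> b mod 3 = 2" by linarith
    then show ?thesis by (auto simp: set_vocab_def)
  qed
  then show ?case by (auto intro!: over_vocab_has_bits)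
qed (auto intro!: over_vocab_has_bits simp: set_vocab_def)

lemma free_vars_is_set: "d \<le> q \<Longrightarrow> free_vars (is_set q d t) \<subseteq> {..q - d}"
proof (induction d arbitrary: t)
  case 0
  show ?case
    unfolding is_set.simps by (rule free_vars_has_bits) (auto simp: level_size_def)
next
  case (Suc d)
  have "free_vars (is_set q d b) \<subseteq> insert (q - d) {..q - Suc d}" for b
    using Suc.IH[of b] Suc.prems by fastforce
  then show ?case
    unfolding is_set.simps by (intro free_vars_has_bits) (use Suc.prems in force)
qed

text \<open>The base case is quantifier-free, because the bits of a urelement are read off against
  path elements already bound; only descents along \<open>Child\<close> cost a quantifier.\<close>

lemma quant_rank_is_set: "quant_rank (is_set q d t) \<le> d"
proof (induction d arbitrary: t)
  case 0
  show ?case unfolding is_set.simps by (rule quant_rank_has_bits) simp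
next
  case (Suc d)
  then show ?case unfolding is_set.simps by (intro quant_rank_has_bits) simp
qed

text \<open>Each descent binds a variable at the next level, preserving the invariant that variable
  \<open>i\<close> has level \<open>i\<close> and hence probes bits \<open>3 * i\<close> to
  \<open>3 * i + 2\<close>. The size bounds ensure that the tested bits determine the code.\<close>

lemma sat_is_set:
  assumes "d \<le> q" "t < level_size q (Suc d)" "s (q - d) div Suc q < level_size q (Suc d)"
    and "\<And>i. i \<le> q - d \<Longrightarrow> s i \<in> univ (set_structure q u) \<and> s i mod Suc q = i"
  shows "sat (set_structure q u) s (is_set q d t) \<longleftrightarrow> s (q - d) div Suc q = t"
  using assms
proof (induction d arbitrary: s t)
  case 0
  let ?M = "set_structure q u"
  have bit: "sat ?M s (Rel (Bit (b mod 3)) [b div 3, q]) \<longleftrightarrow> b \<in> set_decode (s q div Suc q)"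
    if "b < level_size q 0" for b
  proof -
    \<comment> \<open>There are \<open>3 * (q + 1)\<close> bits, so the index stays among the path
      variables.\<close>
    have "b div 3 \<le> q" using that by (simp add: level_size_def)
    then have s: "s (b div 3) mod Suc q = b div 3" "s (b div 3) \<in> univ ?M" "s q \<in> univ ?M"
      using "0.prems"(4)[of "b div 3"] "0.prems"(4)[of q] by auto
    have "3 * (b div 3) + b mod 3 = b" by simp
    then show ?thesis
      using s by (simp add: set_structure_def Let_def)
  qed
  have "sat ?M s (is_set q 0 t) \<longleftrightarrow>
      (\<forall>b<level_size q 0. b \<in> set_decode t \<longleftrightarrow> b \<in> set_decode (s q div Suc q))"
    using bit by (simp add: sat_has_bits)
  also have "\<dots> \<longleftrightarrow> s q div Suc q = t"
    using "0.prems"(2,3) set_decode_eqI[of t "level_size q 0" "s q div Suc q"]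
    by (auto simp: level_size_def)
  finally show ?case by simp
next
  case (Suc d)
  let ?M = "set_structure q u"
  let ?v = "s (q - Suc d) div Suc q"
  let ?\<psi> = "\<lambda>b. Ex (q - d) (Conj (Rel Child [q - Suc d, q - d]) (is_set q d b))"
  have neq: "q - Suc d \<noteq> q - d" and Sucd: "q - d = Suc (q - Suc d)"
    using Suc.prems(1) by auto
  have par: "s (q - Suc d) \<in> univ ?M" "s (q - Suc d) mod Suc q = q - Suc d"
    using Suc.prems(4) by auto
  \<comment> \<open>The induction hypothesis requires members to have codes within the range that
    \<open>is_set q d\<close> can identify.\<close>
  have elem_less: "b < level_size q (Suc d)" if "b \<in> set_decode ?v" for b
    using that Suc.prems(3) by (auto intro: set_decode_less simp: level_size_def)
  have child: "sat ?M s (?\<psi> b) \<longleftrightarrow> b \<in> set_decode ?v" if b: "b < level_size q (Suc d)" for b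
  proof -
    have rel: "sat ?M (s(q - d := a)) (Rel Child [q - Suc d, q - d]) \<longleftrightarrow>
        a mod Suc q = q - d \<and> a div Suc q \<in> set_decode ?v" if "a \<in> univ ?M" for a
      using par neq that Sucd by (simp add: set_structure_def Let_def)
    have sub: "sat ?M (s(q - d := a)) (is_set q d b) \<longleftrightarrow> a div Suc q = b"
      if "a \<in> univ ?M" "a mod Suc q = q - d" "a div Suc q \<in> set_decode ?v" for a
    proof -
      have "i \<le> q - Suc d" if "i \<le> q - d" "i \<noteq> q - d" for i
        using that by linarith
      then have "(s(q - d := a)) i \<in> univ ?M \<and> (s(q - d := a)) i mod Suc q = i" if "i \<le> q - d" for i
        using Suc.prems(4) \<open>a \<in> univ ?M\<close> \<open>a mod Suc q = q - d\<close> that by (cases "i = q - d") auto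
      then show ?thesis
        using Suc.IH[of b "s(q - d := a)"] Suc.prems(1) b elem_less[OF that(3)] by fastforce
    qed
    show ?thesis
    proof
      assume "sat ?M s (?\<psi> b)"
      then show "b \<in> set_decode ?v" using rel sub by auto
    next
      assume bv: "b \<in> set_decode ?v"
      \<comment> \<open>The copy of \<open>b\<close> at the level following that of its parent. It
        lies in the universe because level sizes grow with the height.\<close>
      define a where "a = b * Suc q + (q - d)"
      have less: "q - d < Suc q" by simp
      have a: "a mod Suc q = q - d" "a div Suc q = b"
        unfolding a_def using less by (auto simp del: mult_Suc_right)
      have "level_size q (Suc d) \<le> level_size q (Suc q)"
        unfolding level_size_def using Suc.prems(1) by (intro tower_mono_height) simp
      then have "a div Suc q < level_size q (Suc q)" using a b by simp
      then have "a \<in> univ ?M"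
        unfolding univ_set_structure by (simp add: div_less_iff_less_mult del: mult_Suc_right)
      then show "sat ?M s (?\<psi> b)"
        using rel[of a] sub[of a] a bv by auto
    qed
  qed
  have "sat ?M s (is_set q (Suc d) t) \<longleftrightarrow>
      (\<forall>b<level_size q (Suc d). b \<in> set_decode t \<longleftrightarrow> b \<in> set_decode ?v)"
    unfolding is_set.simps sat_has_bits using child by blast
  also have "\<dots> \<longleftrightarrow> ?v = t"
    using Suc.prems(2,3) set_decode_eqI[of t "level_size q (Suc d)" ?v]
    by (auto simp: level_size_def)
  finally show ?case .
qed

definition has_top :: "nat \<Rightarrow> nat \<Rightarrow> fm" where
  "has_top q b = Ex 0 (Conj (Rel Top [0]) (is_set q q b))"

lemma has_top_FO: "has_top q b \<in> FO set_vocab (q + 1)"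
  using over_vocab_is_set[of q q b] free_vars_is_set[of q q b] quant_rank_is_set[of q q b]
  by (auto simp: FO_def has_top_def set_vocab_def)

text \<open>At \<open>d = q\<close> the invariant of \<open>sat_is_set\<close> concerns variable 0
  only, so \<open>s\<close> may be arbitrary.\<close>

lemma sat_has_top:
  assumes "b < level_size q (Suc q)"
  shows "sat (set_structure q u) s (has_top q b) \<longleftrightarrow> b \<in> set_decode u"
proof -
  let ?M = "set_structure q u"
  have rel: "sat ?M (s(0 := a)) (Rel Top [0]) \<longleftrightarrow> a mod Suc q = 0 \<and> a div Suc q \<in> set_decode u"
    if "a \<in> univ ?M" for a
    using that by (simp add: set_structure_def Let_def)
  have sub: "sat ?M (s(0 := a)) (is_set q q b) \<longleftrightarrow> a div Suc q = b"
    if "a \<in> univ ?M" "a mod Suc q = 0" for a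
  proof -
    have "a div Suc q < level_size q (Suc q)"
      using that(1) unfolding univ_set_structure
      by (simp add: div_less_iff_less_mult del: mult_Suc_right)
    then show ?thesis
      using sat_is_set[of q q b "s(0 := a)" u] that assms by simp
  qed
  show ?thesis
  proof
    assume "sat ?M s (has_top q b)"
    then show "b \<in> set_decode u" using rel sub by (auto simp: has_top_def)
  next
    assume "b \<in> set_decode u"
    define a where "a = b * Suc q"
    have "a \<in> univ ?M"
      using assms by (simp add: a_def univ_set_structure del: mult_Suc_right)
    moreover have "a mod Suc q = 0" "a div Suc q = b"
      by (simp_all add: a_def del: mult_Suc_right)
    ultimately have "sat ?M (s(0 := a)) (Conj (Rel Top [0]) (is_set q q b))"
      using rel[of a] sub[of a] \<open>b \<in> set_decode u\<close> by simp
    then show "sat ?M s (has_top q b)"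
      using \<open>a \<in> univ ?M\<close> unfolding has_top_def sat.simps(7) by blast
  qed
qed

section \<open>Comparing the two counts\<close>

lemma card_atoms_set_vocab_less: "card (atoms set_vocab q) < 2 ^ (3 * Suc q)"
proof -
  have "(q + 1) ^ 3 \<le> (2 ^ q) ^ 3"
    using less_exp[of q] by (intro power_mono) (auto simp: Suc_le_eq)
  moreover have "(2 :: nat) ^ (3 * Suc q) = 8 * (2 ^ q) ^ 3"
    by (simp add: power_mult power_add mult.commute flip: power_mult)
  ultimately have "8 * (q + 1) ^ 3 \<le> 2 ^ (3 * Suc q)"
    by simp
  moreover have "card (atoms set_vocab q) \<le> q\<^sup>2 + (\<Sum>R\<in>set_vocab. q ^ arity R)"
    using finite_atoms_and_card[of set_vocab q] by (simp add: set_vocab_def)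
  \<comment> \<open>Two ternary symbols, five binary ones and one unary. The count is cubic, which
    the three bits per path element match through \<open>q + 1 \<le> 2 ^ q\<close>.\<close>
  moreover have "(\<Sum>R\<in>set_vocab. q ^ arity R) = 2 * q ^ 3 + 5 * q\<^sup>2 + q"
    by (simp add: set_vocab_def)
  moreover have "q\<^sup>2 + (2 * q ^ 3 + 5 * q\<^sup>2 + q) < 8 * (q + 1) ^ 3"
    by (simp add: power2_eq_square power3_eq_cube algebra_simps)
  ultimately show ?thesis by linarith
qed

theorem theorem6p1:
  shows "\<exists>\<tau>. finite \<tau> \<and> arith_vocab \<subseteq> \<tau> \<and>
    (\<forall>q::nat. \<exists>\<phi>\<in>FO \<tau> (q + 1). \<forall>\<psi>\<in>FO \<tau> q.
       \<not> equivalent_on (arith_structures \<tau> :: nat struct set) \<phi> \<psi>)"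
proof (intro exI[of _ set_vocab] conjI allI)
  show fin: "finite set_vocab" and "arith_vocab \<subseteq> set_vocab"
    by (auto simp: set_vocab_def arith_vocab_def)
  fix q :: nat
  let ?At = "atoms set_vocab q"
  let ?U = "{..<level_size q (Suc (Suc q))}"
  have finAt: "finite ?At" using finite_atoms_and_card[OF fin] by blast
  then obtain e where e: "bij_betw e ?At {..<card ?At}"
    using ex_bij_betw_finite_nat by (metis atLeast0LessThan)
  define T where "T u = rank_type e ?At (set_structure q u) q []" for u
  have "T ` ?U \<subseteq> {..<tower (card ?At) (Suc q)}"
    unfolding T_def using rank_type_less e
    by (metis bij_betw_imp_surj_on image_subsetI lessThan_iff order_refl)
  then have "card (T ` ?U) \<le> tower (card ?At) (Suc q)"
    using card_mono[OF finite_lessThan] by (metis card_lessThan)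
  also have "\<dots> < tower (2 ^ (3 * Suc q)) (Suc q)"
    using tower_less_mono card_atoms_set_vocab_less by blast
  also have "\<dots> = card ?U"
    unfolding level_size_def by (simp only: tower_Suc card_lessThan)
  finally have "\<not> inj_on T ?U" by (rule pigeonhole)
  then obtain u w where uw: "u \<in> ?U" "w \<in> ?U" "T u = T w" "u \<noteq> w"
    unfolding inj_on_def by blast
  \<comment> \<open>Distinct codes differ in some bit; the separating sentence depends on this bit
    alone and is fixed before \<psi>.\<close>
  obtain b where b: "b < level_size q (Suc q)" "b \<in> set_decode u \<longleftrightarrow> b \<notin> set_decode w"
    using set_decode_eqI[of u "level_size q (Suc q)" w] uw by (auto simp: level_size_def)
  show "\<exists>\<phi>\<in>FO set_vocab (q + 1). \<forall>\<psi>\<in>FO set_vocab q.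
      \<not> equivalent_on (arith_structures set_vocab :: nat struct set) \<phi> \<psi>"
  proof (intro bexI[OF _ has_top_FO[of q b]] ballI notI)
    fix \<psi> assume \<psi>: "\<psi> \<in> FO set_vocab q"
      and eq: "equivalent_on (arith_structures set_vocab :: nat struct set) (has_top q b) \<psi>"
    have "sat (set_structure q u) s \<psi> \<longleftrightarrow> sat (set_structure q w) s \<psi>" for s
      \<comment> \<open>Empty tuples suffice, as \<psi> has no free variables.\<close>
      by (rule rank_type_eq_sat[of e set_vocab q _ _ q "[]" "[]"])
        (use e finAt uw(3) \<psi> finite_univ_set_structure univ_set_structure_nonempty
          in \<open>auto simp: T_def FO_def bij_betw_def\<close>)
    then have "models (set_structure q u) \<psi> \<longleftrightarrow> models (set_structure q w) \<psi>"
      by (simp add: models_def univ_set_structure)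
    then have "models (set_structure q u) (has_top q b) \<longleftrightarrow> models (set_structure q w) (has_top q b)"
      using eq set_structure_arith by (metis equivalent_on_def)
    moreover have "models (set_structure q v) (has_top q b) \<longleftrightarrow> b \<in> set_decode v" for v
    proof -
      \<comment> \<open>Without an assignment into the universe, \<open>models\<close> would hold
        vacuously.\<close>
      obtain a where "a \<in> univ (set_structure q v)"
        using univ_set_structure_nonempty by blast
      then have "range (\<lambda>_::nat. a) \<subseteq> univ (set_structure q v)" by auto
      then show ?thesis
        unfolding models_def using sat_has_top[OF b(1)] by blast
    qed
    ultimately show False using b(2) by blast
  qed
qed

end
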